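(* For integers $b\geq a\geq 1$ with $a+b=n-6$, $E_{\mathcal{E}}(T_{n,5}^{a,b})>E_{\mathcal{E}}(T_{n,3}^{0,n-4})$.
   Context: For a connected graph $G$ on $n$ vertices, the eccentricity matrix $\mathcal{E}(G)$ is the matrix indexed by $V(G)$ with $(u,v)$-entry $d_G(u,v)$ if $d_G(u,v)=\min\{e_G(u),e_G(v)\}$ and $0$ otherwise, where $d_G$ is the distance and $e_G(u)=\max_v d_G(u,v)$ the eccentricity. The $\mathcal{E}$-energy is $E_{\mathcal{E}}(G)=\sum_{i}|\xi_i(G)|$, the sum of absolute values of the eigenvalues of $\mathcal{E}(G)$. For odd $d\geq 3$ and $b\geq a\geq 0$ with $a+b=n-d-1$, $T_{n,d}^{a,b}$ is the tree obtained from the path $v_0v_1\cdots v_d$ by attaching $a$ pendant vertices to $v_{(d-1)/2}$ and $b$ pendant vertices to $v_{(d+1)/2}$. *)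

theory Defs
  imports "Graph_Theory.Graph_Theory" "Jordan_Normal_Form.Char_Poly"
begin

text \<open>
  A simple graph is a \<^locale>\<open>pair_graph\<close>: a finite, loop-free, symmetric digraph without
  multiple arcs. An undirected edge is the pair of arcs in both directions.
\<close>

definition graph_dist :: "'a pair_pre_digraph \<Rightarrow> 'a \<Rightarrow> 'a \<Rightarrow> nat" where
  "graph_dist G u v = (LEAST k. \<exists>p. pre_digraph.awalk (with_proj G) u p v \<and> length p = k)"

lemma (in pair_wf_digraph) graph_dist_eq_\<mu>:
  assumes "u \<rightarrow>\<^sup>*\<^bsub>with_proj G\<^esub> v"
  shows "ereal (real (graph_dist G u v)) = \<mu> (\<lambda>_. 1) u v"
proof -
  let ?P = "\<lambda>k. \<exists>p. awalk u p v \<and> length p = k"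
  have cost: "awalk_cost (\<lambda>_. 1) p = real (length p)" for p :: "('a \<times> 'a) awalk"
    by (induction p) auto
  have "\<exists>k. ?P k" using assms by (auto simp: reachable_awalk)
  then have "?P (graph_dist G u v)" unfolding graph_dist_def by (rule LeastI_ex)
  then obtain p where p: "awalk u p v" "length p = graph_dist G u v" by blast
  have "graph_dist G u v \<le> length q" if "awalk u q v" for q
    unfolding graph_dist_def using that by (intro Least_le) blast
  then have "ereal (real (graph_dist G u v)) \<le> \<mu> (\<lambda>_. 1) u v"
    unfolding \<mu>_def by (intro INF_greatest) (auto simp: cost)
  moreover have "\<mu> (\<lambda>_. 1) u v \<le> ereal (real (graph_dist G u v))"
    using min_cost_le_walk_cost[OF p(1), of "\<lambda>_. 1"] by (simp add: cost p(2))
  ultimately show ?thesis by (rule antisym)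
qed

definition eccentricity :: "'a pair_pre_digraph \<Rightarrow> 'a \<Rightarrow> nat" where
  "eccentricity G u = Max (graph_dist G u ` pverts G)"

text \<open>
  Matrices are indexed by initial segments of the naturals, so the vertices are listed in
  increasing order; the spectrum does not depend on this choice.
\<close>

definition ecc_matrix :: "'a::linorder pair_pre_digraph \<Rightarrow> real mat" where
  "ecc_matrix G =
     (let n = card (pverts G); vs = sorted_list_of_set (pverts G) in
      mat n n (\<lambda>(i, j).
        let u = vs ! i; v = vs ! j in
        if graph_dist G u v = min (eccentricity G u) (eccentricity G v)
        then real (graph_dist G u v) else 0))"

text \<open>The eigenvalues are taken in the complex numbers, with algebraic multiplicity.\<close>

definition ecc_energy :: "'a::linorder pair_pre_digraph \<Rightarrow> real" where
  "ecc_energy G =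
     (\<Sum>\<xi>\<in>#proots (char_poly (map_mat complex_of_real (ecc_matrix G))). cmod \<xi>)"

text \<open>
  The tree $T_{n,d}^{a,b}$, intended for odd \<open>d\<close> and \<open>n = d + 1 + a + b\<close>. Vertex \<open>i \<le> d\<close> is
  $v_i$; the next \<open>a\<close> numbers are the pendant vertices at $v_{(d-1)/2}$ and the last \<open>b\<close> those
  at $v_{(d+1)/2}$.
\<close>

definition tree_T_arcs :: "nat \<Rightarrow> nat \<Rightarrow> nat \<Rightarrow> (nat \<times> nat) set" where
  "tree_T_arcs d a b =
     {(i, i + 1) |i. i < d} \<union>
     {((d - 1) div 2, v) |v. v \<in> {d + 1..<d + 1 + a}} \<union>
     {((d + 1) div 2, v) |v. v \<in> {d + 1 + a..<d + 1 + a + b}}"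

definition tree_T :: "nat \<Rightarrow> nat \<Rightarrow> nat \<Rightarrow> nat \<Rightarrow> nat pair_pre_digraph" where
  "tree_T n d a b =
     \<lparr> pverts = {..<n}, parcs = tree_T_arcs d a b \<union> (tree_T_arcs d a b)\<inverse> \<rparr>"

lemma pair_graph_tree_T:
  assumes "n = d + 1 + a + b"
  shows "pair_graph (tree_T n d a b)"
proof -
  let ?G = "tree_T n d a b"
  have sub: "parcs ?G \<subseteq> {..<n} \<times> {..<n}"
    using assms unfolding tree_T_def tree_T_arcs_def by auto
  have wf: "pair_wf_digraph ?G"
    using sub by unfold_locales (auto simp: tree_T_def)
  have fin: "finite (parcs ?G)"
    using sub by (rule finite_subset) simp
  have sym: "symmetric ?G"
    by (auto simp: symmetric_def tree_T_def intro!: symI)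
  have loop: "fst e \<noteq> snd e" if "e \<in> parcs ?G" for e
    using that unfolding tree_T_def tree_T_arcs_def by auto
  show ?thesis
    using wf fin sym loop
    by (auto simp: pair_graph_def pair_digraph_def pair_pseudo_graph_def pair_fin_digraph_def
        pair_fin_digraph_axioms_def pair_loopfree_digraph_def pair_loopfree_digraph_axioms_def
        pair_sym_digraph_def pair_sym_digraph_axioms_def tree_T_def)
qed

lemma strongly_connected_tree_T:
  assumes n: "n = d + 1 + a + b"
  shows "strongly_connected (with_proj (tree_T n d a b))"
proof -
  let ?G = "tree_T n d a b"
  interpret pair_graph ?G using n by (rule pair_graph_tree_T)
  have wf: "wf_digraph (with_proj ?G)" by (rule wf_digraph_wp_iff[THEN iffD2]) (rule pair_wf_digraph)
  have sym: "symmetric (with_proj ?G)" by (auto simp: symmetric_def tree_T_def intro!: symI)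
  note adj_trans = wf_digraph.reachable_adj_trans[OF wf]
  have path: "0 \<rightarrow>\<^sup>*\<^bsub>with_proj ?G\<^esub> i" if "i \<le> d" for i
    using that
  proof (induction i)
    case 0
    have "0 \<in> pverts ?G" using n by (simp add: tree_T_def)
    then show ?case by (rule reachable_refl)
  next
    case (Suc i)
    have "i \<rightarrow>\<^bsub>with_proj ?G\<^esub> Suc i"
      using Suc.prems by (auto simp: tree_T_def tree_T_arcs_def)
    with Suc show ?case by (auto intro: adj_trans)
  qed
  have from0: "0 \<rightarrow>\<^sup>*\<^bsub>with_proj ?G\<^esub> v" if v: "v < n" for v
  proof -
    consider "v \<le> d" | "v \<in> {d + 1..<d + 1 + a}" | "v \<in> {d + 1 + a..<d + 1 + a + b}"
      using v n by fastforce
    then show ?thesis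
    proof cases
      case 1
      then show ?thesis by (rule path)
    next
      case 2
      then have "((d - 1) div 2) \<rightarrow>\<^bsub>with_proj ?G\<^esub> v"
        by (auto simp: tree_T_def tree_T_arcs_def)
      moreover have "0 \<rightarrow>\<^sup>*\<^bsub>with_proj ?G\<^esub> ((d - 1) div 2)"
        by (rule path) presburger
      ultimately show ?thesis by (rule adj_trans[rotated])
    next
      case 3
      then have "((d + 1) div 2) \<rightarrow>\<^bsub>with_proj ?G\<^esub> v"
        by (auto simp: tree_T_def tree_T_arcs_def)
      moreover have "0 \<rightarrow>\<^sup>*\<^bsub>with_proj ?G\<^esub> ((d + 1) div 2)"
        by (rule path) presburger
      ultimately show ?thesis by (rule adj_trans[rotated])
    qed
  qed
  show ?thesis
  proof (rule strongly_connectedI)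
    show "verts (with_proj ?G) \<noteq> {}" using n by (auto simp: tree_T_def)
  next
    fix u v
    assume "u \<in> verts (with_proj ?G)" "v \<in> verts (with_proj ?G)"
    then have "u < n" "v < n" by (simp_all add: tree_T_def)
    then have "0 \<rightarrow>\<^sup>*\<^bsub>with_proj ?G\<^esub> u" "0 \<rightarrow>\<^sup>*\<^bsub>with_proj ?G\<^esub> v"
      by (simp_all only: from0)
    then show "u \<rightarrow>\<^sup>*\<^bsub>with_proj ?G\<^esub> v"
      by (metis wf_digraph.reachable_trans[OF wf] symmetric_reachable[OF sym])
  qed
qed

end

theory Submission
  imports Defs
begin

text \<open>
  Both eccentricity matrices have the form \<open>e\<^sub>s w\<^sup>T + w e\<^sub>s\<^sup>T + e\<^sub>t z\<^sup>T + z e\<^sub>t\<^sup>T\<close>, hence rank at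
  most 4. Sylvester's determinant identity \<open>x\<^sup>m det (x I - A B) = x\<^sup>n det (x I - B A)\<close> then
  gives the characteristic polynomial, up to a power of \<open>x\<close>, as a biquadratic
  \<open>x\<^sup>4 - c x\<^sup>2 + e\<close>. Its roots are \<open>\<plusminus>s\<close> and \<open>\<plusminus>t\<close> with \<open>s\<^sup>2 + t\<^sup>2 = c\<close> and
  \<open>s t = sqrt e\<close>, so the energy is \<open>2 (s + t) = 2 sqrt (c + 2 sqrt e)\<close>. The
  comparison of the two closed forms follows from \<open>8 y \<le> y\<^sup>2 + 16\<close>.
\<close>

section \<open>Characteristic polynomials of matrices of low rank\<close>

text \<open>The block matrix \<open>?M\<close> is made block upper triangular in two ways:
  multiplying by \<open>?R\<close> on the right leaves its determinant unchanged, and multiplying by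
  \<open>?L\<close> on the left costs the factor \<open>x ^ m\<close>. No division occurs, so the
  identity is available over a polynomial ring.\<close>

lemma det_Sylvester:
  fixes A B :: "'a::idom mat"
  assumes A: "A \<in> carrier_mat n m" and B: "B \<in> carrier_mat m n"
  shows "x ^ m * det (x \<cdot>\<^sub>m 1\<^sub>m n - A * B) = x ^ n * det (x \<cdot>\<^sub>m 1\<^sub>m m - B * A)"
proof -
  let ?M = "four_block_mat (x \<cdot>\<^sub>m 1\<^sub>m n) A B (1\<^sub>m m)"
  let ?R = "four_block_mat (1\<^sub>m n) (0\<^sub>m n m) (- B) (1\<^sub>m m)"
  let ?L = "four_block_mat (1\<^sub>m n) (0\<^sub>m n m) (- B) (x \<cdot>\<^sub>m 1\<^sub>m m)"
  have xn: "x \<cdot>\<^sub>m 1\<^sub>m n \<in> carrier_mat n n" and xm: "x \<cdot>\<^sub>m 1\<^sub>m m \<in> carrier_mat m m"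
    and mB: "- B \<in> carrier_mat m n" and AB: "A * B \<in> carrier_mat n n"
    and BA: "B * A \<in> carrier_mat m m"
    using A B by auto
  have M: "?M \<in> carrier_mat (n + m) (n + m)" and R: "?R \<in> carrier_mat (n + m) (n + m)"
    and L: "?L \<in> carrier_mat (n + m) (n + m)"
    using xn xm by auto
  have "det ?M = det ?M * det ?R"
    by (subst det_four_block_mat_upper_right_zero[of _ n _ m], insert mB, auto)
  also have "\<dots> = det (?M * ?R)" using det_mult[OF M R] ..
  also have "?M * ?R = four_block_mat (x \<cdot>\<^sub>m 1\<^sub>m n - A * B) A (0\<^sub>m m n) (1\<^sub>m m)"
    by (subst mult_four_block_mat[OF xn A B one_carrier_mat one_carrier_mat zero_carrier_mat mB one_carrier_mat],
        rule cong_four_block_mat, insert A B AB, auto)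
  also have "det \<dots> = det (x \<cdot>\<^sub>m 1\<^sub>m n - A * B)"
    by (subst det_four_block_mat_lower_left_zero[of _ n _ m], insert A B AB, auto)
  finally have 1: "det ?M = det (x \<cdot>\<^sub>m 1\<^sub>m n - A * B)" .
  have "x ^ m * det ?M = det ?L * det ?M"
    by (subst (2) det_four_block_mat_upper_right_zero[of _ n _ m], insert mB xm, auto)
  also have "\<dots> = det (?L * ?M)" using det_mult[OF L M] ..
  also have "?L * ?M = four_block_mat (x \<cdot>\<^sub>m 1\<^sub>m n) A (0\<^sub>m m n) (x \<cdot>\<^sub>m 1\<^sub>m m - B * A)"
    by (subst mult_four_block_mat[OF one_carrier_mat zero_carrier_mat mB xm xn A B one_carrier_mat],
        rule cong_four_block_mat, insert A B BA, auto)
  also have "det \<dots> = x ^ n * det (x \<cdot>\<^sub>m 1\<^sub>m m - B * A)"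
    using det_four_block_mat_lower_left_zero[OF xn A refl minus_carrier_mat[OF BA, of "x \<cdot>\<^sub>m 1\<^sub>m m"]]
    by simp
  finally show ?thesis using 1 by simp
qed

lemma char_poly_altdef:
  assumes "A \<in> carrier_mat n n"
  shows "char_poly A = det ([:0, 1:] \<cdot>\<^sub>m 1\<^sub>m n - map_mat (\<lambda>a. [:a:]) A)"
  unfolding char_poly_defs using assms by (intro arg_cong[where f = det] eq_matI) auto

text \<open>Sylvester's identity over the polynomial ring, with \<open>x\<close> the indeterminate
  and the entries of \<open>A\<close> and \<open>B\<close> embedded as constants.\<close>

lemma char_poly_mult_commute:
  fixes A B :: "'a::idom mat"
  assumes A: "A \<in> carrier_mat n m" and B: "B \<in> carrier_mat m n"
  shows "[:0, 1:] ^ m * char_poly (A * B) = [:0, 1:] ^ n * char_poly (B * A)"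
proof -
  interpret C: comm_ring_hom "\<lambda>a::'a. [:a:]"
    by unfold_locales (auto simp: one_pCons)
  have AB: "A * B \<in> carrier_mat n n" and BA: "B * A \<in> carrier_mat m m" using A B by auto
  show ?thesis
    using det_Sylvester[of "map_mat (\<lambda>a. [:a:]) A" n m "map_mat (\<lambda>a. [:a:]) B" "[:0, 1:]"] A B
    by (simp add: char_poly_altdef[OF AB] char_poly_altdef[OF BA] C.mat_hom_mult[OF A B] C.mat_hom_mult[OF B A])
qed

lemma det_2x2: "A \<in> carrier_mat 2 2 \<Longrightarrow> det A = A $$ (0,0) * A $$ (1,1) - A $$ (0,1) * A $$ (1,0)"
  by (subst laplace_expansion_row[of _ 2 0])
     (auto simp: numeral_2_eq_2 cofactor_def det_single mat_delete_def)

text \<open>\<open>M\<close> factors as \<open>U * V\<close>, where \<open>U\<close> has columns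
  e_s, e_t, w, z and \<open>V\<close> has rows w, z, e_s, e_t, so it suffices to treat the 4x4
  matrix \<open>V * U\<close>. Its characteristic polynomial has linear coefficient -2 (w t)
  \<beta>; the assumption \<open>w t * \<beta> = 0\<close> makes it biquadratic.\<close>

lemma char_poly_rank_4:
  fixes w z :: "nat \<Rightarrow> 'a::idom"
  assumes st: "s < n" "t < n" "s \<noteq> t" and w: "w s = 0" and z: "z s = 0" "z t = 0"
  assumes a: "(\<Sum>k<n. w k * w k) = \<alpha>" and b: "(\<Sum>k<n. w k * z k) = \<beta>"
    and g: "(\<Sum>k<n. z k * z k) = \<gamma>" and "w t * \<beta> = 0"
  defines "M \<equiv> mat n n (\<lambda>(i, j). of_bool (i = s) * w j + w i * of_bool (j = s)
                             + of_bool (i = t) * z j + z i * of_bool (j = t))"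
  shows "[:0, 1:] ^ 4 * char_poly M =
    [:0, 1:] ^ n * [:\<alpha> * \<gamma> - \<beta>\<^sup>2 - (w t)\<^sup>2 * \<gamma>, 0, - (\<alpha> + \<gamma>), 0, 1:]"
proof -
  define U where "U = mat n 4 (\<lambda>(i, k). [of_bool (i = s), of_bool (i = t), w i, z i] ! k)"
  define V where "V = mat 4 n (\<lambda>(k, j). [w j, z j, of_bool (j = s), of_bool (j = t)] ! k)"
  have U: "U \<in> carrier_mat n 4" and V: "V \<in> carrier_mat 4 n" by (auto simp: U_def V_def)
  have "M = U * V"
    by (rule eq_matI) (auto simp: M_def U_def V_def scalar_prod_def numeral_eq_Suc algebra_simps)
  have b': "(\<Sum>k<n. z k * w k) = \<beta>" using b by (simp add: mult.commute)
  have dl: "(\<Sum>k<n. of_bool (k = i) * f k) = f i" "(\<Sum>k<n. f k * of_bool (k = i)) = f i" if "i < n"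
    for i and f :: "nat \<Rightarrow> 'a"
    using that by (auto simp: of_bool_def if_distrib[of "\<lambda>x. x * _"] if_distrib[of "\<lambda>x. _ * x"] cong: if_cong)
  have m1: "[:- 1:] = (- 1 :: 'a poly)"
    by (simp add: one_pCons)
  let ?X = "[:0, 1:] :: 'a poly"
  let ?P = "mat 2 2 (\<lambda>(i, j). [[?X, [: - w t:]], [0, ?X]] ! i ! j)"
  let ?Q = "mat 2 2 (\<lambda>(i, j). [[[: - \<alpha>:], [: - \<beta>:]], [[: - \<beta>:], [: - \<gamma>:]]] ! i ! j)"
  let ?S = "mat 2 2 (\<lambda>(i, j). [[?X, 0], [[: - w t:], ?X]] ! i ! j)"
  \<comment> \<open>The lower left block is minus the identity and commutes with \<open>?S\<close>,
    so the 4x4 determinant reduces to that of the 2x2 matrix \<open>?P * ?S + ?Q\<close>.\<close>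
  have "char_poly (V * U) = det (four_block_mat ?P ?Q (- 1\<^sub>m 2) ?S)"
    unfolding char_poly_defs
  proof (intro arg_cong[where f = det] eq_matI)
    fix i j assume "i < dim_row (four_block_mat ?P ?Q (- 1\<^sub>m 2) ?S)"
      "j < dim_col (four_block_mat ?P ?Q (- 1\<^sub>m 2) ?S)"
    then have "i \<in> {0,1,2,3}" "j \<in> {0,1,2,3}" by auto
    then show "([:0, 1:] \<cdot>\<^sub>m 1\<^sub>m (dim_row (V * U)) + map_mat (\<lambda>a. [:- a:]) (V * U)) $$ (i, j) =
      four_block_mat ?P ?Q (- 1\<^sub>m 2) ?S $$ (i, j)"
      using st w z a b g b'
      by (auto simp: U_def V_def scalar_prod_def numeral_eq_Suc atLeast0LessThan dl m1)
  qed (auto simp: U_def V_def)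
  also have "\<dots> = det (?P * ?S - ?Q * (- 1\<^sub>m 2))"
    by (rule det_four_block_mat) auto
  also have "\<dots> = [:\<alpha> * \<gamma> - \<beta>\<^sup>2 - (w t)\<^sup>2 * \<gamma>, 0, - (\<alpha> + \<gamma>), 0, 1:]"
    using \<open>w t * \<beta> = 0\<close>
    by (subst det_2x2) (auto simp: scalar_prod_def numeral_2_eq_2 algebra_simps power2_eq_square)
  finally show ?thesis using char_poly_mult_commute[OF U V] \<open>M = U * V\<close> by simp
qed

section \<open>Energy from a biquadratic characteristic polynomial\<close>

lemma energy_biquadratic:
  fixes A :: "real mat"
  assumes A: "A \<in> carrier_mat n n"
    and cp: "[:0, 1:] ^ k * char_poly A = [:0, 1:] ^ m * [:e, 0, - c, 0, 1:]"
    and e: "0 \<le> e" and c: "2 * sqrt e \<le> c"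
  shows "(\<Sum>\<xi>\<in>#proots (char_poly (map_mat complex_of_real A)). cmod \<xi>) = 2 * sqrt (c + 2 * sqrt e)"
proof -
  interpret P: map_poly_comm_ring_hom "of_real :: real \<Rightarrow> complex" ..
  \<comment> \<open>The roots are to be \<plusminus>s and \<plusminus>t, and (s \<plusminus> t)^2 =
    c \<plusminus> 2 sqrt e, so \<open>p\<close> and \<open>q\<close> stand for s + t and s - t. The
    bound on \<open>c\<close> makes \<open>q\<close> real.\<close>
  define p where "p = sqrt (c + 2 * sqrt e)"
  define q where "q = sqrt (c - 2 * sqrt e)"
  define s where "s = (p + q) / 2"
  define t where "t = (p - q) / 2"
  have "0 \<le> sqrt e" using e by simp
  moreover from this have "0 \<le> c + 2 * sqrt e" using c by linarith
  ultimately have p2: "p\<^sup>2 = c + 2 * sqrt e" and q2: "q\<^sup>2 = c - 2 * sqrt e" and "0 \<le> q" "q \<le> p"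
    using c by (auto simp: p_def q_def)
  then have "0 \<le> s" "0 \<le> t" by (auto simp: s_def t_def)
  have "s\<^sup>2 + t\<^sup>2 = (p\<^sup>2 + q\<^sup>2) / 2" "s * t = (p\<^sup>2 - q\<^sup>2) / 4"
    by (simp_all add: s_def t_def power2_eq_square field_simps)
  then have c_eq: "c = s\<^sup>2 + t\<^sup>2" and "s * t = sqrt e" using p2 q2 by auto
  then have e_eq: "e = (s * t)\<^sup>2" using e by simp
  have "[:e, 0, - c, 0, 1:] = [:s, 1:] * [:- s, 1:] * ([:t, 1:] * [:- t, 1:])"
    unfolding c_eq e_eq by (simp add: power2_eq_square algebra_simps)
  with cp have "map_poly complex_of_real ([:0, 1:] ^ k * char_poly A) =
      map_poly complex_of_real ([:0, 1:] ^ m * ([:s, 1:] * [:- s, 1:] * ([:t, 1:] * [:- t, 1:])))"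
    by simp
  then have eq: "[:0, 1:] ^ k * char_poly (map_mat complex_of_real A) =
      [:0, 1:] ^ m * ([:of_real s, 1:] * [:- of_real s, 1:] * ([:of_real t, 1:] * [:- of_real t, 1:]))"
    by (simp add: of_real_hom.char_poly_hom[OF A] P.hom_mult P.hom_power
        of_real_hom.map_poly_pCons_hom del: mult_pCons_left mult_pCons_right)
  have X: "proots ([:0, 1:] ^ j :: complex poly) = replicate_mset j 0" for j
    by (simp add: proots_power)
  \<comment> \<open>\<open>proots\<close> is additive only on products of nonzero
    polynomials.\<close>
  have cp0: "char_poly (map_mat complex_of_real A) \<noteq> 0"
    using degree_monic_char_poly[of "map_mat complex_of_real A" n] A by auto
  have "replicate_mset k 0 + proots (char_poly (map_mat complex_of_real A)) =
      proots ([:0, 1:] ^ k * char_poly (map_mat complex_of_real A))"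
    using cp0 by (simp add: proots_mult X del: mult_pCons_left mult_pCons_right)
  also have "\<dots> = replicate_mset m 0 + {#- of_real s, of_real s, - of_real t, of_real t#}"
    unfolding eq by (simp add: proots_mult X del: mult_pCons_left mult_pCons_right)
  \<comment> \<open>The powers of the indeterminate add only zero roots, which contribute nothing to
    the sum of moduli.\<close>
  finally have "(\<Sum>\<xi>\<in>#replicate_mset k 0 + proots (char_poly (map_mat complex_of_real A)). cmod \<xi>) =
      (\<Sum>\<xi>\<in>#replicate_mset m 0 + {#- of_real s, of_real s, - of_real t, of_real t#}. cmod \<xi>)"
    by (rule arg_cong)
  also have "\<dots> = 2 * (s + t)" using \<open>0 \<le> s\<close> \<open>0 \<le> t\<close> by simp
  also have "s + t = p" by (simp add: s_def t_def field_simps)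
  finally show ?thesis by (simp add: p_def)
qed

section \<open>Distances and eccentricities in the trees\<close>

text \<open>A certificate for a distance function from \<open>u\<close>: following predecessors
  gives a walk of length \<open>D v\<close>, and since \<open>D\<close> grows by at most one along
  an arc, no walk to \<open>v\<close> is shorter.\<close>

lemma graph_dist_eqI:
  assumes "pair_wf_digraph G" and u: "u \<in> pverts G"
    and D0: "\<And>v. v \<in> pverts G \<Longrightarrow> D v = 0 \<longleftrightarrow> v = u"
    and lip: "\<And>x y. (x, y) \<in> parcs G \<Longrightarrow> D y \<le> Suc (D x)"
    and pred: "\<And>v. v \<in> pverts G \<Longrightarrow> v \<noteq> u \<Longrightarrow> \<exists>x. (x, v) \<in> parcs G \<and> D v = Suc (D x)"
    and v: "v \<in> pverts G"
  shows "graph_dist G u v = D v"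
proof -
  interpret pair_wf_digraph G by fact
  have ex: "\<exists>p. awalk u p v \<and> length p = D v" if "v \<in> pverts G" for v
    using that
  proof (induction "D v" arbitrary: v)
    case 0
    then have "v = u" using D0 by simp
    then show ?case using 0 D0[of u] u by (auto simp: awalk_Nil_iff)
  next
    case (Suc k)
    then have "v \<noteq> u" using D0[of v] by auto
    with pred Suc.prems obtain x where x: "(x, v) \<in> parcs G" "D v = Suc (D x)" by blast
    then have "x \<in> pverts G" using in_arcsD1 by auto
    with Suc x obtain p where "awalk u p x" "length p = D x" by auto
    then have "awalk u (p @ [(x, v)]) v" "length (p @ [(x, v)]) = D v"
      using x Suc.prems by (auto intro!: awalk_appendI simp: awalk_Cons_iff awalk_Nil_iff)
    then show ?case by blast
  qed
  have "D w \<le> D x + length p" if "awalk x p w" for x p w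
    using that
  proof (induction p arbitrary: x)
    case (Cons a p)
    then have "(x, snd a) \<in> parcs G" "awalk (snd a) p w"
      by (auto simp: awalk_Cons_iff)
    with Cons.IH[of "snd a"] lip[of x "snd a"] show ?case by simp
  qed (simp add: awalk_Nil_iff)
  then have lb: "D v \<le> length p" if "awalk u p v" for p
    using that D0[OF u] by fastforce
  show ?thesis
    unfolding graph_dist_def by (rule Least_equality) (use ex[OF v] lb in auto)
qed

text \<open>The nearest vertex of the path v_0 ... v_d; \<open>height\<close> is the distance to
  it.\<close>

definition foot :: "nat \<Rightarrow> nat \<Rightarrow> nat \<Rightarrow> nat" where
  "foot d a v = (if v \<le> d then v else if v < d + 1 + a then (d - 1) div 2 else (d + 1) div 2)"

definition height :: "nat \<Rightarrow> nat \<Rightarrow> nat" where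
  "height d v = (if v \<le> d then 0 else 1)"

text \<open>A shortest route runs through both feet. Equal arguments are separate because the
  formula would give 2 for a pendant vertex and itself.\<close>

definition tree_dist :: "nat \<Rightarrow> nat \<Rightarrow> nat \<Rightarrow> nat \<Rightarrow> nat" where
  "tree_dist d a u v = (if u = v then 0 else
     nat \<bar>int (foot d a u) - int (foot d a v)\<bar> + height d u + height d v)"

lemma graph_dist_tree_T:
  assumes d: "d = 2 * h + 1" and n: "n = d + 1 + a + b" and "u < n" "v < n"
  shows "graph_dist (tree_T n d a b) u v = tree_dist d a u v"
proof (rule graph_dist_eqI)
  let ?G = "tree_T n d a b"
  show "pair_wf_digraph ?G"
    using pair_graph_tree_T[OF n]
    by (auto simp: pair_graph_def pair_digraph_def pair_pseudo_graph_def pair_fin_digraph_def)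
  show "u \<in> pverts ?G" "v \<in> pverts ?G" using assms by (auto simp: tree_T_def)
  note defs = tree_dist_def foot_def height_def
  have half: "(d - 1) div 2 = h" "(d + 1) div 2 = h + 1" using d by auto
  show "tree_dist d a u x = 0 \<longleftrightarrow> x = u" if "x \<in> pverts ?G" for x
    using that d by (auto simp: defs half)
  show "tree_dist d a u y \<le> Suc (tree_dist d a u x)" if "(x, y) \<in> parcs ?G" for x y
  proof -
    \<comment> \<open>An arc joins either a pendant vertex to its foot or two consecutive path
      vertices.\<close>
    have "x \<noteq> y \<and> (height d x + height d y = 1 \<and> foot d a x = foot d a y \<or> height d x = 0 \<and> height d y = 0 \<and>
        (foot d a y = foot d a x + 1 \<or> foot d a x = foot d a y + 1))"
      using that d by (auto simp: tree_T_def tree_T_arcs_def half foot_def height_def)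
    then show ?thesis unfolding tree_dist_def by (elim conjE disjE) auto
  qed
  show "\<exists>x. (x, v) \<in> parcs ?G \<and> tree_dist d a u v = Suc (tree_dist d a u x)"
    if v: "v \<in> pverts ?G" and "v \<noteq> u" for v
  proof -
    have A: "(i, i + 1) \<in> parcs ?G" "(i + 1, i) \<in> parcs ?G" if "i < d" for i
      using that by (auto simp: tree_T_def tree_T_arcs_def)
    have P: "(foot d a x, x) \<in> parcs ?G" if "d < x" "x < n" for x
      using that n d by (auto simp: tree_T_def tree_T_arcs_def half foot_def)
    have Q: "(x, foot d a x) \<in> parcs ?G" if "d < x" "x < n" for x
      using that n d by (auto simp: tree_T_def tree_T_arcs_def half foot_def)
    have fd: "foot d a x \<le> d" for x using d by (auto simp: foot_def half)
    have vn: "v < n" using v by (simp add: tree_T_def)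
    \<comment> \<open>The predecessor is the next vertex on the way from \<open>v\<close> to
      \<open>u\<close>: the foot of a pendant \<open>v\<close>, a path neighbour on the side of the
      foot of \<open>u\<close>, or, if \<open>v\<close> is that foot, the pendant vertex
      \<open>u\<close> itself.\<close>
    consider "d < v" | "v \<le> d" "foot d a u < v" | "v \<le> d" "v < foot d a u"
      | "v \<le> d" "foot d a u = v" by linarith
    then show ?thesis
    proof cases
      case 1
      then show ?thesis using P[OF 1 vn] \<open>v \<noteq> u\<close> fd[of v]
        by (intro exI[of _ "foot d a v"])
           (auto simp: tree_dist_def height_def foot_def[of d a "foot d a v"])
    next
      case 2
      then have "foot d a v = v" "height d v = 0" "foot d a (v - 1) = v - 1" "height d (v - 1) = 0"
        by (auto simp: foot_def height_def)
      then have "tree_dist d a u v = Suc (tree_dist d a u (v - 1))"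
        using 2 \<open>v \<noteq> u\<close> unfolding tree_dist_def by (cases "u = v - 1") auto
      then show ?thesis using A(1)[of "v - 1"] 2 by (intro exI[of _ "v - 1"]) auto
    next
      case 3
      with fd[of u] have "foot d a v = v" "height d v = 0" "foot d a (v + 1) = v + 1"
          "height d (v + 1) = 0"
        by (auto simp: foot_def height_def)
      then have "tree_dist d a u v = Suc (tree_dist d a u (v + 1))"
        using 3 \<open>v \<noteq> u\<close> unfolding tree_dist_def by (cases "u = v + 1") auto
      then show ?thesis using A(2)[of v] 3 fd[of u] by (intro exI[of _ "v + 1"]) auto
    next
      case 4
      then have "d < u" using \<open>v \<noteq> u\<close> by (auto simp: foot_def split: if_splits)
      then show ?thesis using 4 Q[of u] \<open>u < n\<close> \<open>v \<noteq> u\<close>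
        by (intro exI[of _ u]) (auto simp: tree_dist_def height_def foot_def[of d a v])
    qed
  qed
qed

text \<open>Some end of the path is always a farthest vertex: as \<open>0 < h\<close>, pendant
  vertices hang at inner path vertices and reach no further than the ends do.\<close>

lemma eccentricity_tree_T:
  assumes d: "d = 2 * h + 1" "0 < h" and n: "n = d + 1 + a + b" and u: "u < n"
  shows "eccentricity (tree_T n d a b) u = max (foot d a u) (d - foot d a u) + height d u"
proof -
  have half: "(d - 1) div 2 = h" "(d + 1) div 2 = h + 1" using d by auto
  have "graph_dist (tree_T n d a b) u ` pverts (tree_T n d a b) = tree_dist d a u ` {..<n}"
    using graph_dist_tree_T[OF d(1) n u] by (auto simp: tree_T_def)
  moreover have "Max (tree_dist d a u ` {..<n}) = max (foot d a u) (d - foot d a u) + height d u"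
  proof (rule Max_eqI)
    fix y assume "y \<in> tree_dist d a u ` {..<n}"
    then obtain v where y: "y = tree_dist d a u v" by blast
    have "height d v \<le> foot d a v" "foot d a v + height d v \<le> d" "foot d a u \<le> d"
      using d by (auto simp: foot_def height_def half)
    then show "y \<le> max (foot d a u) (d - foot d a u) + height d u"
      unfolding y tree_dist_def by auto
  next
    have "foot d a u \<le> d" using d by (auto simp: foot_def half)
    then have "tree_dist d a u 0 = foot d a u + height d u"
        "tree_dist d a u d = d - foot d a u + height d u"
      by (auto simp: tree_dist_def foot_def[of _ _ 0] foot_def[of d a d] height_def)
    then have "max (foot d a u) (d - foot d a u) + height d u =
        tree_dist d a u (if d - foot d a u \<le> foot d a u then 0 else d)"
      by simp
    moreover have "(if d - foot d a u \<le> foot d a u then 0 else d) \<in> {..<n}" using n by auto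
    ultimately show "max (foot d a u) (d - foot d a u) + height d u \<in> tree_dist d a u ` {..<n}"
      by blast
  qed simp
  ultimately show ?thesis by (simp add: eccentricity_def)
qed

lemma ecc_matrix_tree_T:
  assumes "d = 2 * h + 1" "0 < h" "n = d + 1 + a + b"
  shows "ecc_matrix (tree_T n d a b) = mat n n (\<lambda>(u, v).
    if tree_dist d a u v = min (max (foot d a u) (d - foot d a u) + height d u)
                               (max (foot d a v) (d - foot d a v) + height d v)
    then real (tree_dist d a u v) else 0)"
proof -
  have V: "pverts (tree_T n d a b) = {..<n}" by (simp add: tree_T_def)
  have S: "sorted_list_of_set {..<n} = [0..<n]"
    by (simp add: lessThan_atLeast0)
  show ?thesis
    unfolding ecc_matrix_def Let_def V S
    by (rule eq_matI)
       (simp_all add: graph_dist_tree_T[OF assms(1,3)] eccentricity_tree_T[OF assms])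
qed

lemma sum_lessThan_add:
  fixes f :: "nat \<Rightarrow> 'a::comm_monoid_add"
  shows "(\<Sum>k<m + n. f k) = (\<Sum>k<m. f k) + (\<Sum>k<n. f (m + k))"
  by (induction n) (simp_all add: add.assoc)

section \<open>Closed forms of the two energies\<close>

lemma ecc_energy_tree_T_3:
  "ecc_energy (tree_T (4 + b) 3 0 b) = 2 * sqrt (13 * real (b + 1) + 4 + 8 * sqrt (b + 1))"
proof -
  let ?n = "4 + b"
  \<comment> \<open>\<open>w\<close> and \<open>z\<close> are the rows of v_0 and v_1, which cover
    all nonzero entries up to symmetry. The pendant vertices at v_2 have the same entries as
    v_3.\<close>
  define w :: "nat \<Rightarrow> real" where "w k = (if k < 2 then 0 else if k = 2 then 2 else 3)" for k
  define z :: "nat \<Rightarrow> real" where "z k = (if k < 3 then 0 else 2)" for k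
  note split = sum_lessThan_add[of _ 4 b]
  have s: "(\<Sum>k<?n. w k * w k) = 9 * real b + 13" "(\<Sum>k<?n. w k * z k) = 6 * real b + 6"
    "(\<Sum>k<?n. z k * z k) = 4 * real b + 4"
    unfolding split by (simp_all add: w_def z_def numeral_eq_Suc)
  define M where "M = mat ?n ?n (\<lambda>(i, j). of_bool (i = 0) * w j + w i * of_bool (j = 0)
                             + of_bool (i = 1) * z j + z i * of_bool (j = 1))"
  have M: "ecc_matrix (tree_T ?n 3 0 b) = M"
    unfolding ecc_matrix_tree_T[of 3 1 ?n 0 b, simplified] M_def
  proof (intro cong_mat refl, clarify)
    fix i j assume "i < ?n" "j < ?n"
    have "i = 0 \<or> i = 1 \<or> i = 2 \<or> i = 3 \<or> 3 < i" "j = 0 \<or> j = 1 \<or> j = 2 \<or> j = 3 \<or> 3 < j" by auto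
    then show "(if tree_dist 3 0 i j = min (max (foot 3 0 i) (3 - foot 3 0 i) + height 3 i)
         (max (foot 3 0 j) (3 - foot 3 0 j) + height 3 j)
        then real (tree_dist 3 0 i j) else 0) =
      of_bool (i = 0) * w j + w i * of_bool (j = 0) + of_bool (i = 1) * z j + z i * of_bool (j = 1)"
      by (elim disjE) (simp_all add: tree_dist_def foot_def height_def w_def z_def)
  qed
  \<comment> \<open>Here \<open>w 1 = 0\<close>, so the constant term is \<alpha> \<gamma> -
    \<beta>^2 = (9b + 13)(4b + 4) - 36 (b + 1)^2.\<close>
  have cp: "[:0, 1:] ^ 4 * char_poly M = [:0, 1:] ^ ?n * [:16 * real (b + 1), 0, - (13 * real (b + 1) + 4), 0, 1:]"
    using char_poly_rank_4[of 0 ?n 1 w z, OF _ _ _ _ _ _ s, folded M_def]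
    by (simp add: w_def z_def power2_eq_square algebra_simps)
  \<comment> \<open>The mean inequality gives the bound 16 + (b + 1), which is at most the
    right-hand side because b + 1 \<ge> 1.\<close>
  have "2 * sqrt (16 * real (b + 1)) \<le> 13 * real (b + 1) + 4"
    using arith_geo_mean_sqrt[of 16 "real (b + 1)"] by simp
  from energy_biquadratic[OF _ cp _ this, of ?n]
  show ?thesis
    using real_sqrt_mult[of 16 "real (b + 1)"]
    by (simp add: ecc_energy_def M) (simp add: M_def)
qed

lemma ecc_energy_tree_T_5:
  "ecc_energy (tree_T (6 + a + b) 5 a b) =
     2 * sqrt (16 * real (a + b) + 75 + 2 * sqrt ((16 * real a + 25) * (16 * real b + 25)))"
proof -
  let ?n = "6 + a + b"
  \<comment> \<open>\<open>w\<close> and \<open>z\<close> are the rows of \<open>v\<^sub>0\<close> and \<open>v\<^sub>5\<close>; their common entry 5 is kept in \<open>w\<close> only.\<close>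
  define w :: "nat \<Rightarrow> real" where
    "w k = (if k < 3 then 0 else if k < 6 then real k else if k < 6 + a then 0 else 4)" for k
  define z :: "nat \<Rightarrow> real" where
    "z k = (if k = 1 then 4 else if k = 2 then 3 else if 6 \<le> k \<and> k < 6 + a then 4 else 0)" for k
  note split = sum_lessThan_add[of _ "6 + a" b] sum_lessThan_add[of _ 6 a]
  have s: "(\<Sum>k<?n. w k * w k) = 16 * real b + 50" "(\<Sum>k<?n. w k * z k) = 0"
    "(\<Sum>k<?n. z k * z k) = 16 * real a + 25"
    unfolding split by (simp_all add: w_def z_def numeral_eq_Suc)
  define M where "M = mat ?n ?n (\<lambda>(i, j). of_bool (i = 0) * w j + w i * of_bool (j = 0)
                             + of_bool (i = 5) * z j + z i * of_bool (j = 5))"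
  have M: "ecc_matrix (tree_T ?n 5 a b) = M"
    unfolding ecc_matrix_tree_T[of 5 2 ?n a b, simplified] M_def
  proof (intro cong_mat refl, clarify)
    fix i j assume "i < ?n" "j < ?n"
    \<comment> \<open>Six path vertices and two families of pendant vertices. Two vertices of one
      family are at distance 0 or 2, below their eccentricity 4, so the entry is 0 in either
      case.\<close>
    then have "i = 0 \<or> i = 1 \<or> i = 2 \<or> i = 3 \<or> i = 4 \<or> i = 5 \<or> 5 < i \<and> i < 6 + a \<or> 5 < i \<and> \<not> i < 6 + a"
      "j = 0 \<or> j = 1 \<or> j = 2 \<or> j = 3 \<or> j = 4 \<or> j = 5 \<or> 5 < j \<and> j < 6 + a \<or> 5 < j \<and> \<not> j < 6 + a" by auto
    then show "(if tree_dist 5 a i j = min (max (foot 5 a i) (5 - foot 5 a i) + height 5 i)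
         (max (foot 5 a j) (5 - foot 5 a j) + height 5 j)
        then real (tree_dist 5 a i j) else 0) =
      of_bool (i = 0) * w j + w i * of_bool (j = 0) + of_bool (i = 5) * z j + z i * of_bool (j = 5)"
      by (elim disjE) (simp_all add: tree_dist_def foot_def height_def w_def z_def)
  qed
  \<comment> \<open>The supports of \<open>w\<close> and \<open>z\<close> are disjoint, so \<beta> =
    0, and \<open>w 5 = 5\<close>; the constant term is therefore (\<alpha> - 25) \<gamma>.\<close>
  have cp: "[:0, 1:] ^ 4 * char_poly M =
    [:0, 1:] ^ ?n * [:(16 * real a + 25) * (16 * real b + 25), 0, - (16 * real (a + b) + 75), 0, 1:]"
    using char_poly_rank_4[of 0 ?n 5 w z, OF _ _ _ _ _ _ s, folded M_def]
    by (simp add: w_def z_def power2_eq_square algebra_simps)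
  have "2 * sqrt ((16 * real a + 25) * (16 * real b + 25)) \<le> 16 * real (a + b) + 75"
    using arith_geo_mean_sqrt[of "16 * real a + 25" "16 * real b + 25"] by simp
  from energy_biquadratic[OF _ cp _ this, of ?n]
  show ?thesis
    by (simp add: ecc_energy_def M) (simp add: M_def)
qed

section \<open>Comparison of the closed forms\<close>

theorem theorem4p2:
  fixes n a b :: nat
  assumes "1 \<le> a" and "a \<le> b" and "a + b + 6 = n"
  shows "ecc_energy (tree_T n 5 a b) > ecc_energy (tree_T n 3 0 (n - 4))"
proof -
  \<comment> \<open>The smaller tree energy has n - 4 = a + b + 2 pendant vertices, so its formula
    involves the square root of a + b + 3.\<close>
  define s where "s = sqrt (real (a + b + 3))"
  have "s\<^sup>2 = a + b + 3" by (simp add: s_def)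
  moreover have "0 \<le> (s - 4)\<^sup>2" by simp
  ultimately have s: "8 * s \<le> real (a + b) + 19" by (simp add: power2_eq_square algebra_simps)
  define r where "r = sqrt ((16 * real a + 25) * (16 * real b + 25))"
  have "0 \<le> r" by (simp add: r_def)
  \<comment> \<open>By the bound on \<open>s\<close> the left-hand side is at most 14 (a + b) +
    62.\<close>
  with s have "13 * real (a + b + 3) + 4 + 8 * s < 16 * real (a + b) + 75 + 2 * r"
    by simp
  then show ?thesis
    using ecc_energy_tree_T_5[of a b] ecc_energy_tree_T_3[of "a + b + 2"] assms(3)
    by (auto simp: s_def r_def ac_simps)
qed

end
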